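(* Let $\mu$ be a Borel probability measure on $2^\omega$. Let $(s_i)_{i\in\omega}$ be reals with $s_i\in[0,1)$ and $\sum_i s_i<\infty$, and let $(A_i)_{i\in\omega}$ be subsets of $2^\omega$ such that player II has a winning strategy in the measure game $G(s_i,A_i)$ for every $i$. Then player II has a winning strategy in $G\big(0,\bigcup_{m=1}^\infty\bigcap_{i=m}^\infty A_i\big)$.
   Context: $2^\omega$ is the space of infinite binary sequences with the product topology; $2^{<\omega}$ is the set of finite binary sequences; for $t\in 2^{<\omega}$, $N_t=\{x\in 2^\omega: t\subseteq x\}$, and $t^\frown i$ denotes $t$ extended by the digit $i$. For $A\subseteq 2^\omega$ and $s\in[0,1)$ the measure game $G(s,A)$ is played as follows: in round $n$, after II has played $t=x_0\dots x_{n-1}$ (for $n=0$, $t=\emptyset$), player I plays a pair $(m_{t^\frown 0},m_{t^\frown 1})$, and then II plays $x_n$. Put $m_\emptyset=m_0+m_1$. Player I must obey: every $m_t$ is rational; $m_0+m_1>s$; $0\le m_t\le\mu(N_t)$; if $\mu(N_t)>0$ then $m_t<\mu(N_t)$; $m_{t^\frown0}+m_{t^\frown1}=m_t$. Player II must obey: $x_n\in\{0,1\}$ and $m_{x_0\dots x_n}\ne 0$ for all $n$. The first player to violate a rule loses; if both follow the rules, II wins iff $x=(x_0,x_1,\dots)\in A$, and otherwise I wins. *)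

theory Defs
  imports "HOL-Probability.Probability"
begin

text \<open>
  The space $2^\omega$ is the type \<open>nat \<Rightarrow> bool\<close> with the library's product topology
  (\<open>bool\<close> is discrete), and $2^{<\omega}$ is the type \<open>bool list\<close>; the digits 0 and 1 are
  \<open>False\<close> and \<open>True\<close>.
\<close>

definition restr :: "(nat \<Rightarrow> 'a) \<Rightarrow> nat \<Rightarrow> 'a list" where
  "restr x n = map x [0..<n]"

definition cyl :: "bool list \<Rightarrow> (nat \<Rightarrow> bool) set" where
  "cyl t = {x. restr x (length t) = t}"

text \<open>
  A run of the measure game consists of the moves \<open>p :: nat \<Rightarrow> real \<times> real\<close> of player I and the
  moves \<open>x :: nat \<Rightarrow> bool\<close> of player II. With \<open>t = restr x n\<close>, the pair \<open>p n\<close> is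
  $(m_{t^\frown 0}, m_{t^\frown 1})$, so only the numbers $m_u$ with \<open>u\<close> empty or of the form
  $t^\frown i$ occur in the run. Here \<open>run_mass p x n\<close> is $m_t$; player I's moves are arbitrary
  pairs of reals, and rationality is one of the rules.
\<close>

definition choose_mass :: "real \<times> real \<Rightarrow> bool \<Rightarrow> real" where
  "choose_mass q i = (if i then snd q else fst q)"

fun run_mass :: "(nat \<Rightarrow> real \<times> real) \<Rightarrow> (nat \<Rightarrow> bool) \<Rightarrow> nat \<Rightarrow> real" where
  "run_mass p x 0 = fst (p 0) + snd (p 0)"
| "run_mass p x (Suc n) = choose_mass (p n) (x n)"

definition legal_mass :: "(nat \<Rightarrow> bool) measure \<Rightarrow> bool list \<Rightarrow> real \<Rightarrow> bool" where
  "legal_mass \<mu> t m \<longleftrightarrow>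
     m \<in> \<rat> \<and> 0 \<le> m \<and> m \<le> measure \<mu> (cyl t) \<and>
     (measure \<mu> (cyl t) > 0 \<longrightarrow> m < measure \<mu> (cyl t))"

definition legal_I ::
  "(nat \<Rightarrow> bool) measure \<Rightarrow> real \<Rightarrow> (nat \<Rightarrow> real \<times> real) \<Rightarrow> (nat \<Rightarrow> bool) \<Rightarrow> nat \<Rightarrow> bool" where
  "legal_I \<mu> s p x n \<longleftrightarrow>
     (n = 0 \<longrightarrow> fst (p 0) + snd (p 0) > s \<and> legal_mass \<mu> [] (run_mass p x 0)) \<and>
     (\<forall>i. legal_mass \<mu> (restr x n @ [i]) (choose_mass (p n) i)) \<and>
     fst (p n) + snd (p n) = run_mass p x n"

text \<open>The rule $x_n \in \{0,1\}$ is enforced by the type of player II's moves.\<close>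

definition legal_II :: "(nat \<Rightarrow> real \<times> real) \<Rightarrow> (nat \<Rightarrow> bool) \<Rightarrow> nat \<Rightarrow> bool" where
  "legal_II p x n \<longleftrightarrow> run_mass p x (Suc n) \<noteq> 0"

text \<open>
  Player I moves first in each round, so player I is the first to violate a rule iff in some round
  \<open>n\<close> player I's move is illegal while all moves of both players in earlier rounds are legal.
\<close>

definition II_wins_run ::
  "(nat \<Rightarrow> bool) measure \<Rightarrow> real \<Rightarrow> (nat \<Rightarrow> bool) set \<Rightarrow>
   (nat \<Rightarrow> real \<times> real) \<Rightarrow> (nat \<Rightarrow> bool) \<Rightarrow> bool" where
  "II_wins_run \<mu> s A p x \<longleftrightarrow>
     (\<exists>n. \<not> legal_I \<mu> s p x n \<and> (\<forall>k<n. legal_I \<mu> s p x k \<and> legal_II p x k)) \<or>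
     ((\<forall>n. legal_I \<mu> s p x n \<and> legal_II p x n) \<and> x \<in> A)"

text \<open>
  A strategy of player II maps a position in which player II is to move, given by the moves
  $p_0, \dots, p_n$ of player I and the moves $x_0, \dots, x_{n-1}$ of player II, to a move $x_n$.
\<close>

type_synonym strategy_II = "(real \<times> real) list \<Rightarrow> bool list \<Rightarrow> bool"

definition follows_II ::
  "strategy_II \<Rightarrow> (nat \<Rightarrow> real \<times> real) \<Rightarrow> (nat \<Rightarrow> bool) \<Rightarrow> bool" where
  "follows_II \<tau> p x \<longleftrightarrow> (\<forall>n. x n = \<tau> (restr p (Suc n)) (restr x n))"

definition winning_strategy_II ::
  "(nat \<Rightarrow> bool) measure \<Rightarrow> real \<Rightarrow> (nat \<Rightarrow> bool) set \<Rightarrow> strategy_II \<Rightarrow> bool" where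
  "winning_strategy_II \<mu> s A \<tau> \<longleftrightarrow>
     (\<forall>p x. follows_II \<tau> p x \<longrightarrow> II_wins_run \<mu> s A p x)"

definition II_has_winning_strategy ::
  "(nat \<Rightarrow> bool) measure \<Rightarrow> real \<Rightarrow> (nat \<Rightarrow> bool) set \<Rightarrow> bool" where
  "II_has_winning_strategy \<mu> s A \<longleftrightarrow> (\<exists>\<tau>. winning_strategy_II \<mu> s A \<tau>)"

end

theory Submission
  imports Defs
begin

text \<open>
  A winning strategy of II in \<open>G(s, A)\<close> makes the complement of \<open>A\<close> have outer measure at most \<open>s\<close>:
  the outcomes of legal runs against the strategy form a subset of \<open>A\<close> obtained by the Souslin
  operation from clopen sets, hence measurable for the completion of \<open>\<mu>\<close>, and if an open \<open>U\<close>
  contained them while \<open>- U\<close> had measure above \<open>s\<close>, player I could distribute rational masses along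
  \<open>- U\<close> and steer a legal run out of \<open>U\<close>. Conversely, II wins \<open>G(0, A)\<close> if the complement of \<open>A\<close> is
  contained in a null set \<open>D\<close>: once the initial mass \<open>m\<close> is known, II picks an open \<open>U \<supseteq> D\<close> of
  measure below \<open>m\<close> and keeps the current mass \<open>m\<^sub>t\<close> above the measure of \<open>U \<inter> N\<^sub>t\<close>. The two facts
  are linked by the Borel--Cantelli lemma.
\<close>

subsection \<open>Initial segments and cylinders\<close>

lemma length_restr [simp]: "length (restr x n) = n"
  by (simp add: restr_def)

lemma restr_0 [simp]: "restr x 0 = []"
  by (simp add: restr_def)

lemma restr_Suc: "restr x (Suc n) = restr x n @ [x n]"
  by (simp add: restr_def)

lemma restr_eq_iff: "restr x n = restr y n \<longleftrightarrow> (\<forall>i<n. x i = y i)"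
  by (auto simp: restr_def)

lemma map_restr: "map f (restr x n) = restr (f \<circ> x) n"
  by (simp add: restr_def)

lemma ex_restr_recursion: "\<exists>p. \<forall>n. p n = f (restr p n)"
proof -
  define ps where "ps = rec_nat [] (\<lambda>_ qs. qs @ [f qs])"
  have "restr (\<lambda>n. f (ps n)) n = ps n" for n
    by (induction n) (auto simp: ps_def restr_Suc)
  then show ?thesis by (intro exI[of _ "\<lambda>n. f (ps n)"]) simp
qed

lemma ex_infinite_branch:
  assumes "P []" and extend: "\<And>ps. P ps \<Longrightarrow> \<exists>q. P (ps @ [q])"
  shows "\<exists>p. \<forall>n. P (restr p n)"
proof -
  obtain f where f: "P (ps @ [f ps])" if "P ps" for ps
    using extend by metis
  obtain p where p: "p n = f (restr p n)" for n
    using ex_restr_recursion[of f] by blast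
  have "P (restr p n)" for n
  proof (induction n)
    case 0
    show ?case using assms(1) by simp
  next
    case (Suc n)
    from f[OF Suc] show ?case by (simp only: restr_Suc p[symmetric])
  qed
  then show ?thesis by blast
qed

lemma mem_cyl_restr [simp]: "y \<in> cyl (restr x n) \<longleftrightarrow> restr y n = restr x n"
  by (simp add: cyl_def)

lemma cyl_Nil [simp]: "cyl [] = UNIV"
  by (simp add: cyl_def)

lemma cyl_eq_Un: "cyl t = cyl (t @ [False]) \<union> cyl (t @ [True])"
  by (auto simp: cyl_def restr_Suc)

lemma cyl_disjoint: "cyl (t @ [False]) \<inter> cyl (t @ [True]) = {}"
  by (auto simp: cyl_def restr_Suc)

lemma closed_cyl: "closed (cyl t)"
proof -
  have "closed {x :: nat \<Rightarrow> bool. x i = t ! i}" for i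
    by (intro closed_Collect_eq continuous_intros continuous_on_product_coordinates)
  moreover have "cyl t = (\<Inter>i\<in>{..<length t}. {x. x i = t ! i})"
    by (auto simp: cyl_def restr_def list_eq_iff_nth_eq[of "map _ _"])
  ultimately show ?thesis by auto
qed

lemma cyl_borel [measurable]: "cyl t \<in> sets borel"
  using closed_cyl by (rule borel_closed)

lemma open_contains_cyl:
  assumes "open U" "x \<in> U"
  shows "\<exists>n. cyl (restr x n) \<subseteq> U"
proof -
  have "openin (product_topology (\<lambda>i. euclidean) UNIV) U"
    using assms(1) by (simp add: open_fun_def)
  from product_topology_open_contains_basis[OF this assms(2)]
  obtain X where X: "x \<in> (\<Pi>\<^sub>E i\<in>UNIV. X i)" "finite {i. X i \<noteq> UNIV}" "(\<Pi>\<^sub>E i\<in>UNIV. X i) \<subseteq> U"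
    by auto
  obtain n where n: "\<forall>i\<in>{i. X i \<noteq> UNIV}. i < n"
    using X(2) finite_nat_set_iff_bounded by blast
  have "cyl (restr x n) \<subseteq> (\<Pi>\<^sub>E i\<in>UNIV. X i)"
    using n X(1) by (fastforce simp: restr_eq_iff PiE_iff)
  with X(3) show ?thesis by blast
qed

lemma borel_if_determined_by_restr:
  fixes C :: "(nat \<Rightarrow> bool) set"
  assumes "\<And>x y. restr x n = restr y n \<Longrightarrow> x \<in> C \<Longrightarrow> y \<in> C"
  shows "C \<in> sets borel"
proof -
  have "C = (\<Union>t\<in>(\<lambda>x. restr x n) ` C. cyl t)"
  proof (intro equalityI subsetI)
    fix y assume "y \<in> (\<Union>t\<in>(\<lambda>x. restr x n) ` C. cyl t)"
    then obtain x where "x \<in> C" "restr y n = restr x n" by auto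
    then show "y \<in> C" using assms[of x y] by simp
  qed auto
  also have "\<dots> \<in> sets borel"
    by (intro sets.countable_UN') auto
  finally show ?thesis .
qed

subsection \<open>Outer regularity\<close>

text \<open>
  The library proves regularity on complete metric spaces, and \<open>bool\<close> carries no metric, so measures
  are pushed forward along an embedding.
\<close>

lemma outer_regular_embedding:
  fixes f :: "'a::topological_space \<Rightarrow> 'b::{second_countable_topology, complete_space}"
    and M :: "'a measure"
  assumes "finite_measure M" and sets: "sets M = sets borel"
    and f: "continuous_on UNIV f" and g: "g \<in> borel_measurable borel" and gf: "\<And>x. g (f x) = x"
    and B: "B \<in> sets borel" "measure M B < c"
  shows "\<exists>U. open U \<and> B \<subseteq> U \<and> measure M U < c"
proof -
  interpret finite_measure M by fact
  have space: "space M = UNIV" using sets_eq_imp_space_eq[OF sets] by simp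
  have f_measurable: "f \<in> measurable M borel"
    using borel_measurable_continuous_onI[OF f] measurable_cong_sets[OF sets refl] by blast
  define N where "N = distr M borel f"
  interpret N: finite_measure N
    unfolding N_def by (rule finite_measure_distr) (rule f_measurable)
  have N: "emeasure N V = ennreal (measure M (f -` V))" if "V \<in> sets borel" for V
    using that by (simp add: N_def emeasure_distr[OF f_measurable] space emeasure_eq_measure)
  have gB: "g -` B \<in> sets borel" using measurable_sets[OF g B(1)] by simp
  have "f -` g -` B = B" by (auto simp: gf)
  then have "emeasure N (g -` B) < ennreal c"
    using B(2) measure_nonneg[of M B] by (simp add: N[OF gB] ennreal_less_iff)
  then have "(INF V\<in>{V. g -` B \<subseteq> V \<and> open V}. emeasure N V) < ennreal c"
    by (subst (asm) outer_regular[OF _ _ gB]) (auto simp: N_def N.emeasure_finite[unfolded N_def])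
  then obtain V where V: "g -` B \<subseteq> V" "open V" "emeasure N V < ennreal c"
    unfolding INF_less_iff by blast
  have "open (f -` V)" using open_vimage[OF V(2) f] .
  moreover have "B \<subseteq> f -` V" using V(1) gf by fastforce
  moreover have "measure M (f -` V) < c"
    using V(2,3) by (simp add: N ennreal_less_iff)
  ultimately show ?thesis by blast
qed

instance bool :: second_countable_topology
proof
  show "\<exists>B :: bool set set. countable B \<and> open = generate_topology B"
    by (intro exI conjI, rule countableI_type, rule open_bool_def)
qed

lemma outer_regular_fun_bool:
  fixes M :: "('i::countable \<Rightarrow> bool) measure"
  assumes "finite_measure M" "sets M = sets borel" "B \<in> sets borel" "measure M B < c"
  shows "\<exists>U. open U \<and> B \<subseteq> U \<and> measure M U < c"
proof -
  define f :: "('i \<Rightarrow> bool) \<Rightarrow> 'i \<Rightarrow> real" where "f x i = of_bool (x i)" for x i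
  define g :: "('i \<Rightarrow> real) \<Rightarrow> 'i \<Rightarrow> bool" where "g y i \<longleftrightarrow> y i > 1/2" for y i
  have "continuous_on UNIV (\<lambda>x. f x i)" for i
    unfolding f_def
    by (rule continuous_on_compose2[OF Topological_Spaces.continuous_on_discrete[of UNIV of_bool]
          continuous_on_product_coordinates]) auto
  then have "continuous_on UNIV f" by (rule continuous_on_coordinatewise_then_product)
  moreover have "g \<in> borel_measurable borel"
  proof (rule measurable_coordinatewise_then_product)
    fix i
    have [measurable]: "(\<lambda>y :: 'i \<Rightarrow> real. y i) \<in> borel_measurable borel"
      by (intro borel_measurable_continuous_onI continuous_on_product_coordinates)
    have "(\<lambda>y. g y i) \<in> measurable borel (count_space UNIV)"
      unfolding g_def by measurable
    then show "(\<lambda>y. g y i) \<in> borel_measurable borel"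
      by (simp cong: measurable_cong_sets[OF refl sets_borel_eq_count_space])
  qed
  moreover have "g (f x) = x" for x by (rule ext) (simp add: f_def g_def)
  ultimately show ?thesis
    using outer_regular_embedding[OF assms(1,2) _ _ _ assms(3,4), of f g] by blast
qed

subsection \<open>The Souslin operation\<close>

definition souslin_from :: "'q set \<Rightarrow> ('q list \<Rightarrow> 'a set) \<Rightarrow> 'q list \<Rightarrow> 'a set" where
  "souslin_from Q C ps =
     {x. \<exists>p. range p \<subseteq> Q \<and> restr p (length ps) = ps \<and> (\<forall>n. x \<in> C (restr p n))}"

abbreviation souslin :: "'q set \<Rightarrow> ('q list \<Rightarrow> 'a set) \<Rightarrow> 'a set" where
  "souslin Q C \<equiv> souslin_from Q C []"

lemma mem_souslin_iff: "x \<in> souslin Q C \<longleftrightarrow> (\<exists>p. range p \<subseteq> Q \<and> (\<forall>n. x \<in> C (restr p n)))"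
  by (simp add: souslin_from_def)

lemma souslin_from_subset: "souslin_from Q C ps \<subseteq> C ps"
  unfolding souslin_from_def by (auto dest: spec[of _ "length ps"])

lemma souslin_from_subset_UN: "souslin_from Q C ps \<subseteq> (\<Union>q\<in>Q. souslin_from Q C (ps @ [q]))"
proof
  fix x assume "x \<in> souslin_from Q C ps"
  then obtain p where p: "range p \<subseteq> Q" "restr p (length ps) = ps" "\<forall>n. x \<in> C (restr p n)"
    by (auto simp: souslin_from_def)
  then have "x \<in> souslin_from Q C (ps @ [p (length ps)])"
    by (auto simp: souslin_from_def restr_Suc)
  then show "x \<in> (\<Union>q\<in>Q. souslin_from Q C (ps @ [q]))"
    using p(1) by blast
qed

lemma measurable_envelope_Diff_null_sets:
  assumes "measurable_envelope M A E" "B \<in> sets M" "A \<subseteq> B"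
  shows "E - B \<in> null_sets M"
proof (rule null_setsI)
  show "E - B \<in> sets M" using measurable_envelopeD(2)[OF assms(1)] assms(2) by blast
  then show "emeasure M (E - B) = 0"
    using measurable_envelopeD1[OF assms(1)] assms(3) by blast
qed

text \<open>
  Outside countably many null sets, membership in the envelope of a position passes to the envelope
  of one of its extensions (Lusin--Sierpinski).
\<close>

theorem souslin_in_sets:
  assumes "finite_measure M" "complete_measure M" "countable Q" and C: "\<And>ps. C ps \<in> sets M"
  shows "souslin Q C \<in> sets M"
proof -
  interpret finite_measure M by fact
  interpret complete_measure M by fact
  have "\<exists>H\<subseteq>C ps. measurable_envelope M (souslin_from Q C ps) H" for ps
    using measurable_envelopeI_countable_cover[of "souslin_from Q C ps" "\<lambda>_. C ps" M]
      souslin_from_subset[of Q C ps] C by (auto simp: less_top[symmetric])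
  then obtain H where H_subset: "H ps \<subseteq> C ps"
    and env: "measurable_envelope M (souslin_from Q C ps) (H ps)" for ps
    by metis
  note H = measurable_envelopeD(1,2)[OF env]
  define Z where "Z ps = H ps - (\<Union>q\<in>Q. H (ps @ [q]))" for ps
  have "Z ps \<in> null_sets M" for ps
    unfolding Z_def
  proof (rule measurable_envelope_Diff_null_sets[OF env])
    show "(\<Union>q\<in>Q. H (ps @ [q])) \<in> sets M"
      using assms(3) H(2) by (intro sets.countable_UN') auto
    show "souslin_from Q C ps \<subseteq> (\<Union>q\<in>Q. H (ps @ [q]))"
      using souslin_from_subset_UN[of Q C ps] H(1) by blast
  qed
  then have W: "(\<Union>ps\<in>lists Q. Z ps) \<in> null_sets M" (is "?W \<in> _")
    using assms(3) by (intro null_sets_UN') auto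
  have "H [] - ?W \<subseteq> souslin Q C"
  proof
    fix x assume x: "x \<in> H [] - ?W"
    have "\<exists>p. \<forall>n. restr p n \<in> lists Q \<and> x \<in> H (restr p n)"
      by (rule ex_infinite_branch) (use x in \<open>auto simp: Z_def\<close>)
    then obtain p where p: "restr p n \<in> lists Q" "x \<in> H (restr p n)" for n by blast
    have "p n \<in> Q" for n using p(1)[of "Suc n"] by (simp add: restr_Suc)
    then show "x \<in> souslin Q C" using p(2) H_subset unfolding mem_souslin_iff by blast
  qed
  then have "souslin Q C = (H [] - ?W) \<union> (souslin Q C \<inter> ?W)"
    using H(1) by blast
  moreover have "souslin Q C \<inter> ?W \<in> sets M"
    by (rule complete[OF _ W]) blast
  moreover have "H [] - ?W \<in> sets M" using H(2) W by blast
  ultimately show ?thesis by (metis sets.Un)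
qed

subsection \<open>Runs of the measure game\<close>

lemma ex_run_against:
  "\<exists>p x. follows_II \<tau> p x \<and> (\<forall>n. p n = \<sigma> (restr p n) (restr x n))"
proof -
  obtain z where z: "z n =
      (let ps = map fst (restr z n); xs = map snd (restr z n); q = \<sigma> ps xs in (q, \<tau> (ps @ [q]) xs))"
      for n
    using ex_restr_recursion[of "\<lambda>zs. let ps = map fst zs; xs = map snd zs; q = \<sigma> ps xs
      in (q, \<tau> (ps @ [q]) xs)"] by blast
  have p: "fst (z n) = \<sigma> (restr (fst \<circ> z) n) (restr (snd \<circ> z) n)" for n
    by (subst z) (simp add: Let_def map_restr)
  have "snd (z n) = \<tau> (restr (fst \<circ> z) (Suc n)) (restr (snd \<circ> z) n)" for n
    by (subst z) (simp add: Let_def map_restr restr_Suc p)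
  then have "follows_II \<tau> (fst \<circ> z) (snd \<circ> z)"
    by (simp add: follows_II_def)
  with p show ?thesis by (metis comp_apply)
qed

lemma run_mass_cong:
  assumes "restr p (Suc n) = restr p' (Suc n)" "restr x n = restr x' n"
  shows "run_mass p x n = run_mass p' x' n"
  using assms by (cases n) (auto simp: restr_Suc)

lemma legal_I_cong:
  assumes "restr p (Suc n) = restr p' (Suc n)" "restr x n = restr x' n"
  shows "legal_I \<mu> s p x n = legal_I \<mu> s p' x' n"
proof -
  have "p n = p' n" "p 0 = p' 0" using assms(1) by (auto simp: restr_eq_iff)
  then show ?thesis
    using run_mass_cong[OF assms] assms(2) by (simp add: legal_I_def)
qed

lemma legal_I_in_Rats:
  assumes "legal_I \<mu> s p x n"
  shows "p n \<in> \<rat> \<times> \<rat>"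
proof -
  have "choose_mass (p n) i \<in> \<rat>" for i
    using assms by (auto simp: legal_I_def legal_mass_def)
  from this[of False] this[of True] show ?thesis
    by (auto simp: choose_mass_def mem_Times_iff)
qed

lemma run_mass_le_measure_cyl:
  assumes "\<And>k. legal_I \<mu> s p x k"
  shows "run_mass p x n \<le> measure \<mu> (cyl (restr x n))"
proof (cases n)
  case 0
  have "legal_mass \<mu> [] (run_mass p x 0)" using assms unfolding legal_I_def by blast
  then show ?thesis by (simp add: 0 legal_mass_def)
next
  case (Suc k)
  have "legal_mass \<mu> (restr x k @ [x k]) (choose_mass (p k) (x k))"
    using assms unfolding legal_I_def by blast
  then show ?thesis by (simp add: Suc restr_Suc legal_mass_def)
qed

lemma II_wins_runI:
  assumes "\<And>n. (\<And>k. k \<le> n \<Longrightarrow> legal_I \<mu> s p x k) \<Longrightarrow> legal_II p x n"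
    and "(\<And>n. legal_I \<mu> s p x n) \<Longrightarrow> x \<in> A"
  shows "II_wins_run \<mu> s A p x"
proof (cases "\<forall>n. legal_I \<mu> s p x n")
  case True
  with assms show ?thesis by (auto simp: II_wins_run_def)
next
  case False
  then obtain n where "\<not> legal_I \<mu> s p x n" "\<forall>k<n. legal_I \<mu> s p x k"
    using exists_least_iff[of "\<lambda>n. \<not> legal_I \<mu> s p x n"] by blast
  with assms(1) show ?thesis
    unfolding II_wins_run_def by (meson order_le_less_trans)
qed

subsection \<open>Outcomes of legal runs against a strategy\<close>

definition legal_round ::
  "(nat \<Rightarrow> bool) measure \<Rightarrow> real \<Rightarrow> strategy_II \<Rightarrow> (nat \<Rightarrow> real \<times> real) \<Rightarrow> (nat \<Rightarrow> bool) \<Rightarrow> nat \<Rightarrow> bool"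
where
  "legal_round \<mu> s \<tau> p x n \<longleftrightarrow>
     x n = \<tau> (restr p (Suc n)) (restr x n) \<and> legal_I \<mu> s p x n \<and> legal_II p x n"

definition outcomes :: "(nat \<Rightarrow> bool) measure \<Rightarrow> real \<Rightarrow> strategy_II \<Rightarrow> (nat \<Rightarrow> bool) set" where
  "outcomes \<mu> s \<tau> = {x. \<exists>p. \<forall>n. legal_round \<mu> s \<tau> p x n}"

definition legal_outcomes_after ::
  "(nat \<Rightarrow> bool) measure \<Rightarrow> real \<Rightarrow> strategy_II \<Rightarrow> (real \<times> real) list \<Rightarrow> (nat \<Rightarrow> bool) set" where
  "legal_outcomes_after \<mu> s \<tau> ps = {x. \<forall>n<length ps. legal_round \<mu> s \<tau> ((!) ps) x n}"

lemma outcomes_subset: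
  assumes "winning_strategy_II \<mu> s A \<tau>"
  shows "outcomes \<mu> s \<tau> \<subseteq> A"
proof
  fix x assume "x \<in> outcomes \<mu> s \<tau>"
  then obtain p where p: "legal_round \<mu> s \<tau> p x n" for n
    by (auto simp: outcomes_def)
  then have "II_wins_run \<mu> s A p x"
    using assms by (simp add: winning_strategy_II_def follows_II_def legal_round_def)
  with p show "x \<in> A" by (simp add: II_wins_run_def legal_round_def)
qed

lemma legal_round_cong:
  assumes p: "restr p (Suc n) = restr p' (Suc n)" and x: "restr x (Suc n) = restr x' (Suc n)"
  shows "legal_round \<mu> s \<tau> p x n = legal_round \<mu> s \<tau> p' x' n"
proof -
  have "restr x n = restr x' n" "x n = x' n" "p n = p' n"
    using p x by (auto simp: restr_Suc)
  then show ?thesis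
    using p legal_I_cong[OF p] by (simp add: legal_round_def legal_II_def)
qed

lemma mem_legal_outcomes_after_restr:
  "x \<in> legal_outcomes_after \<mu> s \<tau> (restr p n) \<longleftrightarrow> (\<forall>k<n. legal_round \<mu> s \<tau> p x k)"
proof -
  have "legal_round \<mu> s \<tau> ((!) (restr p n)) x k = legal_round \<mu> s \<tau> p x k" if "k < n" for k
    using that by (intro legal_round_cong) (auto simp: restr_def)
  then show ?thesis by (simp add: legal_outcomes_after_def)
qed

lemma legal_outcomes_after_borel: "legal_outcomes_after \<mu> s \<tau> ps \<in> sets borel"
proof (rule borel_if_determined_by_restr)
  fix x y assume xy: "restr x (length ps) = restr y (length ps)"
    and x: "x \<in> legal_outcomes_after \<mu> s \<tau> ps"
  have "legal_round \<mu> s \<tau> ((!) ps) y n" if "n < length ps" for n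
  proof -
    have "restr x (Suc n) = restr y (Suc n)" using xy that by (simp add: restr_eq_iff)
    then show ?thesis
      using x that legal_round_cong[OF refl] unfolding legal_outcomes_after_def by blast
  qed
  then show "y \<in> legal_outcomes_after \<mu> s \<tau> ps" by (simp add: legal_outcomes_after_def)
qed

lemma outcomes_eq_souslin: "outcomes \<mu> s \<tau> = souslin (\<rat> \<times> \<rat>) (legal_outcomes_after \<mu> s \<tau>)"
proof -
  have "(range p \<subseteq> \<rat> \<times> \<rat> \<and> (\<forall>n. x \<in> legal_outcomes_after \<mu> s \<tau> (restr p n))) \<longleftrightarrow>
      (\<forall>n. legal_round \<mu> s \<tau> p x n)" for p x
    using legal_I_in_Rats[of \<mu> s p x]
    by (auto simp: mem_legal_outcomes_after_restr legal_round_def image_subset_iff)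
  then show ?thesis
    by (simp add: outcomes_def set_eq_iff mem_souslin_iff)
qed

locale finite_cantor_measure = finite_measure \<mu> for \<mu> :: "(nat \<Rightarrow> bool) measure" +
  assumes sets_eq_borel [simp, measurable_cong]: "sets \<mu> = sets borel"
begin

lemma space_eq_UNIV [simp]: "space \<mu> = UNIV"
  using sets_eq_imp_space_eq[OF sets_eq_borel] by simp

lemma measure_Int_cyl_split:
  assumes "B \<in> sets borel"
  shows "measure \<mu> (B \<inter> cyl t) =
    measure \<mu> (B \<inter> cyl (t @ [False])) + measure \<mu> (B \<inter> cyl (t @ [True]))"
proof -
  have "B \<inter> cyl t = (B \<inter> cyl (t @ [False])) \<union> (B \<inter> cyl (t @ [True]))"
    using cyl_eq_Un[of t] by blast
  moreover have "(B \<inter> cyl (t @ [False])) \<inter> (B \<inter> cyl (t @ [True])) = {}"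
    using cyl_disjoint[of t] by blast
  ultimately show ?thesis
    using assms by (simp add: finite_measure_Union)
qed

lemma outcomes_in_sets_completion: "outcomes \<mu> s \<tau> \<in> sets (completion \<mu>)"
  unfolding outcomes_eq_souslin
proof (rule souslin_in_sets)
  show "finite_measure (completion \<mu>)"
    by (rule finite_measureI) simp
  show "complete_measure (completion \<mu>)"
    by (rule completion.complete_measure_axioms)
  show "countable (\<rat> \<times> \<rat> :: (real \<times> real) set)"
    by (simp add: countable_rat)
  show "legal_outcomes_after \<mu> s \<tau> ps \<in> sets (completion \<mu>)" for ps
    using legal_outcomes_after_borel[of \<mu> s \<tau> ps] by auto
qed

end

subsection \<open>Player I plays on a set\<close>

text \<open>
  Mass 0 is always admitted: player I then has a legal move even after II has moved into a cylinder
  that carries no mass.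
\<close>

definition legal_mass_on :: "(nat \<Rightarrow> bool) measure \<Rightarrow> (nat \<Rightarrow> bool) set \<Rightarrow> bool list \<Rightarrow> real \<Rightarrow> bool" where
  "legal_mass_on \<mu> K t m \<longleftrightarrow> m \<in> \<rat> \<and> 0 \<le> m \<and> (m = 0 \<or> m < measure \<mu> (K \<inter> cyl t))"

definition splits_on ::
  "(nat \<Rightarrow> bool) measure \<Rightarrow> (nat \<Rightarrow> bool) set \<Rightarrow> bool list \<Rightarrow> real \<Rightarrow> real \<times> real \<Rightarrow> bool" where
  "splits_on \<mu> K t m q \<longleftrightarrow>
     fst q + snd q = m \<and> (\<forall>i. legal_mass_on \<mu> K (t @ [i]) (choose_mass q i))"

lemma ex_rational_split:
  fixes a b m :: real
  assumes "m \<in> \<rat>" "0 < m" "m < a + b"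
  shows "\<exists>u\<in>\<rat>. 0 \<le> u \<and> u \<le> m \<and> (u = 0 \<or> u < a) \<and> (m - u = 0 \<or> m - u < b)"
proof -
  consider "m < a" | "m < b" | "a \<le> m" "b \<le> m" by linarith
  then show ?thesis
  proof cases
    case 1
    with assms show ?thesis by (intro bexI[of _ m]) auto
  next
    case 2
    with assms show ?thesis by (intro bexI[of _ 0]) auto
  next
    case 3
    obtain u where "u \<in> \<rat>" "m - b < u" "u < a"
      using Rats_dense_in_real[of "m - b" a] assms(3) by auto
    with 3 show ?thesis by (intro bexI[of _ u]) auto
  qed
qed

context finite_cantor_measure
begin

lemma legal_mass_on_imp_legal_mass:
  assumes "legal_mass_on \<mu> K t m"
  shows "legal_mass \<mu> t m"
proof -
  have "measure \<mu> (K \<inter> cyl t) \<le> measure \<mu> (cyl t)"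
    by (intro finite_measure_mono) auto
  with assms show ?thesis
    by (auto simp: legal_mass_on_def legal_mass_def)
qed

lemma ex_splits_on:
  assumes "K \<in> sets borel" and m: "legal_mass_on \<mu> K t m"
  shows "\<exists>q. splits_on \<mu> K t m q"
proof (cases "m = 0")
  case True
  then show ?thesis
    by (intro exI[of _ "(0, 0)"]) (simp add: splits_on_def legal_mass_on_def choose_mass_def)
next
  case False
  then obtain u where "u \<in> \<rat>" "0 \<le> u" "u \<le> m"
      "u = 0 \<or> u < measure \<mu> (K \<inter> cyl (t @ [False]))"
      "m - u = 0 \<or> m - u < measure \<mu> (K \<inter> cyl (t @ [True]))"
    using ex_rational_split m measure_Int_cyl_split[OF assms(1), of t]
    by (metis legal_mass_on_def less_eq_real_def)
  then show ?thesis
    using m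
    by (intro exI[of _ "(u, m - u)"]) (simp add: splits_on_def legal_mass_on_def choose_mass_def)
qed

lemma ex_run_splitting_on:
  assumes K: "K \<in> sets borel" and m: "legal_mass_on \<mu> K [] m"
  shows "\<exists>p x. follows_II \<tau> p x \<and> run_mass p x 0 = m \<and>
    (\<forall>n. legal_mass_on \<mu> K (restr x n) (run_mass p x n) \<and>
      splits_on \<mu> K (restr x n) (run_mass p x n) (p n))"
proof -
  obtain split where split: "splits_on \<mu> K t a (split t a)" if "legal_mass_on \<mu> K t a" for t a
    using ex_splits_on[OF K] by metis
  define \<sigma> where "\<sigma> ps xs =
    split xs (if ps = [] then m else choose_mass (last ps) (last xs))" for ps xs
  obtain p x where run: "follows_II \<tau> p x" and p: "\<And>n. p n = \<sigma> (restr p n) (restr x n)"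
    using ex_run_against[of \<tau> \<sigma>] by blast
  have "p 0 = split [] m" using p[of 0] by (simp add: \<sigma>_def)
  then have mass_0: "run_mass p x 0 = m"
    using split[OF m] by (simp add: splits_on_def)
  have p_eq: "p n = split (restr x n) (run_mass p x n)" for n
    using p[of n] mass_0 by (cases n) (auto simp: \<sigma>_def restr_Suc)
  have "legal_mass_on \<mu> K (restr x n) (run_mass p x n)" for n
  proof (induction n)
    case 0
    show ?case using m mass_0 by simp
  next
    case (Suc n)
    from split[OF Suc] show ?case
      by (simp add: p_eq[symmetric] splits_on_def restr_Suc)
  qed
  with split p_eq run mass_0 show ?thesis by metis
qed

lemma legal_I_if_splits_on:
  assumes "splits_on \<mu> K (restr x n) (run_mass p x n) (p n)"
    and "legal_mass_on \<mu> K [] (run_mass p x 0)" "s < run_mass p x 0"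
  shows "legal_I \<mu> s p x n"
  using assms by (auto simp: legal_I_def splits_on_def intro: legal_mass_on_imp_legal_mass)

lemma measure_Compl_le_if_outcomes_subset_open:
  assumes "0 \<le> s" and win: "winning_strategy_II \<mu> s A \<tau>"
    and U: "open U" "outcomes \<mu> s \<tau> \<subseteq> U"
  shows "measure \<mu> (- U) \<le> s"
proof (rule ccontr)
  assume "\<not> ?thesis"
  then obtain m where m: "m \<in> \<rat>" "s < m" "m < measure \<mu> (- U)"
    using Rats_dense_in_real[of s "measure \<mu> (- U)"] by auto
  then have m_legal: "legal_mass_on \<mu> (- U) [] m"
    using assms(1) by (simp add: legal_mass_on_def)
  have "- U \<in> sets borel" using U(1) by (simp add: borel_closed)
  then obtain p x where run: "follows_II \<tau> p x" "run_mass p x 0 = m"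
    and mass: "\<And>n. legal_mass_on \<mu> (- U) (restr x n) (run_mass p x n)"
    and splits: "\<And>n. splits_on \<mu> (- U) (restr x n) (run_mass p x n) (p n)"
    using ex_run_splitting_on[OF _ m_legal] by blast
  have "legal_I \<mu> s p x n" for n
    using legal_I_if_splits_on[OF splits] m_legal m(2) run(2) by simp
  then have legal_II: "legal_II p x n" for n
    using win run(1) unfolding winning_strategy_II_def II_wins_run_def by blast
  have "x \<in> outcomes \<mu> s \<tau>"
    using \<open>\<And>n. legal_I \<mu> s p x n\<close> legal_II run(1)
    by (auto simp: outcomes_def legal_round_def follows_II_def)
  then obtain n where "cyl (restr x n) \<subseteq> U"
    using open_contains_cyl U by blast
  moreover have "cyl (restr x (Suc n)) \<subseteq> cyl (restr x n)"
    by (auto simp: restr_eq_iff)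
  ultimately have "cyl (restr x (Suc n)) \<subseteq> U" by blast
  then have "measure \<mu> (- U \<inter> cyl (restr x (Suc n))) = 0"
    by (metis Int_commute disjoint_eq_subset_Compl double_compl measure_empty)
  with mass[of "Suc n"] legal_II[of n] show False
    by (simp add: legal_mass_on_def legal_II_def del: run_mass.simps)
qed

theorem II_wins_imp_measure_Compl_le:
  assumes "0 \<le> s" "II_has_winning_strategy \<mu> s A"
  shows "\<exists>D\<in>sets borel. - A \<subseteq> D \<and> measure \<mu> D \<le> s"
proof -
  obtain \<tau> where win: "winning_strategy_II \<mu> s A \<tau>"
    using assms(2) by (auto simp: II_has_winning_strategy_def)
  obtain E N N' where E: "outcomes \<mu> s \<tau> = E \<union> N" "N \<subseteq> N'" "N' \<in> null_sets \<mu>" "E \<in> sets \<mu>"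
    using outcomes_in_sets_completion by (rule sets_completionE)
  have "measure \<mu> (- E) \<le> s"
  proof (rule field_le_epsilon)
    fix e :: real assume "0 < e"
    then have "measure \<mu> (E \<union> N') < measure \<mu> E + e"
      using E(3,4) by (simp add: measure_Un_null_set)
    then obtain U where U: "open U" "E \<union> N' \<subseteq> U" "measure \<mu> U < measure \<mu> E + e"
      using outer_regular_fun_bool[OF finite_measure_axioms sets_eq_borel, of "E \<union> N'"] E(3,4)
      by (metis null_setsD2 sets.Un sets_eq_borel)
    have "measure \<mu> (- U) \<le> s"
      by (rule measure_Compl_le_if_outcomes_subset_open[OF assms(1) win U(1)]) (use E U(2) in blast)
    then show "measure \<mu> (- E) \<le> s + e"
      using U(1,3) E(4) finite_measure_compl[of U] finite_measure_compl[of E]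
      by (simp add: Compl_eq_Diff_UNIV)
  qed
  then show ?thesis
    using outcomes_subset[OF win] E(1,4) by (intro bexI[of _ "- E"]) auto
qed

end

subsection \<open>Player II avoids a null set\<close>

definition avoiding_strategy ::
  "(nat \<Rightarrow> bool) measure \<Rightarrow> (real \<Rightarrow> (nat \<Rightarrow> bool) set) \<Rightarrow> strategy_II" where
  "avoiding_strategy \<mu> U ps xs \<longleftrightarrow>
     \<not> measure \<mu> (U (fst (hd ps) + snd (hd ps)) \<inter> cyl (xs @ [False])) < fst (last ps)"

lemma follows_avoiding_strategy:
  assumes "follows_II (avoiding_strategy \<mu> U) p x"
  shows "x n \<longleftrightarrow> \<not> measure \<mu> (U (run_mass p x 0) \<inter> cyl (restr x n @ [False])) < fst (p n)"
proof -
  have "hd (restr p (Suc n)) = p 0"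
    by (simp add: restr_def upt_conv_Cons del: upt_Suc)
  moreover have "last (restr p (Suc n)) = p n"
    by (simp add: restr_Suc)
  ultimately show ?thesis
    using assms unfolding follows_II_def avoiding_strategy_def by simp
qed

context finite_cantor_measure
begin

lemma measure_Int_cyl_less_run_mass:
  assumes W: "W \<in> sets borel" "measure \<mu> W < run_mass p x 0"
    and legal: "\<And>k. k < n \<Longrightarrow> legal_I \<mu> s p x k"
    and x: "\<And>k. x k \<longleftrightarrow> \<not> measure \<mu> (W \<inter> cyl (restr x k @ [False])) < fst (p k)"
  shows "measure \<mu> (W \<inter> cyl (restr x n)) < run_mass p x n"
  using legal
proof (induction n)
  case 0
  show ?case using W(2) by simp
next
  case (Suc n)
  have "fst (p n) + snd (p n) = run_mass p x n"
    using Suc.prems[of n] by (simp add: legal_I_def del: run_mass.simps)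
  then have "measure \<mu> (W \<inter> cyl (restr x n @ [False])) + measure \<mu> (W \<inter> cyl (restr x n @ [True]))
      < fst (p n) + snd (p n)"
    using Suc measure_Int_cyl_split[OF W(1), of "restr x n"] by simp
  then show ?case
    using x[of n] by (cases "x n") (auto simp: choose_mass_def restr_Suc)
qed

theorem null_set_imp_II_wins:
  assumes "D \<in> null_sets \<mu>" "- D \<subseteq> A"
  shows "II_has_winning_strategy \<mu> 0 A"
proof -
  have D: "D \<in> sets borel" "measure \<mu> D = 0"
    using assms(1) by (auto simp: null_sets_def measure_def)
  then have "\<exists>U. 0 < m \<longrightarrow> open U \<and> D \<subseteq> U \<and> measure \<mu> U < m" for m
    using outer_regular_fun_bool[OF finite_measure_axioms sets_eq_borel] by metis
  then obtain U where U: "open (U m)" "D \<subseteq> U m" "measure \<mu> (U m) < m" if "0 < m" for m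
    by metis
  have "II_wins_run \<mu> 0 A p x" if run: "follows_II (avoiding_strategy \<mu> U) p x" for p x
  proof (rule II_wins_runI)
    define W where "W = U (run_mass p x 0)"
    have W: "open W" "D \<subseteq> W" "measure \<mu> W < run_mass p x 0" if "legal_I \<mu> 0 p x 0"
      using U[of "run_mass p x 0"] that by (auto simp: W_def legal_I_def)
    have mass: "measure \<mu> (W \<inter> cyl (restr x n)) < run_mass p x n"
      if "legal_I \<mu> 0 p x 0" "\<And>k. k < n \<Longrightarrow> legal_I \<mu> 0 p x k" for n
      using W that follows_avoiding_strategy[OF run]
      by (intro measure_Int_cyl_less_run_mass[where s = 0]) (auto simp: W_def)
    show "legal_II p x n" if "\<And>k. k \<le> n \<Longrightarrow> legal_I \<mu> 0 p x k" for n
      using mass[of "Suc n"] that measure_nonneg[of \<mu> "W \<inter> cyl (restr x (Suc n))"]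
      by (auto simp: legal_II_def simp del: run_mass.simps)
    show "x \<in> A" if legal: "\<And>n. legal_I \<mu> 0 p x n"
    proof (rule ccontr)
      assume "x \<notin> A"
      then have "x \<in> W" using assms(2) W(2) legal by blast
      then obtain n where "cyl (restr x n) \<subseteq> W"
        using open_contains_cyl[OF W(1)[OF legal]] by blast
      then have "measure \<mu> (cyl (restr x n)) < run_mass p x n"
        using mass[OF legal legal, of n] by (simp add: Int_absorb1)
      with run_mass_le_measure_cyl[OF legal, of n] show False by linarith
    qed
  qed
  then show ?thesis
    unfolding II_has_winning_strategy_def winning_strategy_II_def by blast
qed

end

theorem theorem3p1:
  fixes \<mu> :: "(nat \<Rightarrow> bool) measure"
    and s :: "nat \<Rightarrow> real"
    and A :: "nat \<Rightarrow> (nat \<Rightarrow> bool) set"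
  assumes "prob_space \<mu>"
    and "sets \<mu> = sets borel"
    and "\<And>i. 0 \<le> s i \<and> s i < 1"
    and "summable s"
    and "\<And>i. II_has_winning_strategy \<mu> (s i) (A i)"
  shows "II_has_winning_strategy \<mu> 0 (\<Union>m\<in>{1..}. \<Inter>i\<in>{m..}. A i)"
proof -
  interpret prob_space \<mu> by fact
  interpret finite_cantor_measure \<mu> by standard fact
  have "\<exists>D\<in>sets borel. - A i \<subseteq> D \<and> measure \<mu> D \<le> s i" for i
    using II_wins_imp_measure_Compl_le assms(3,5) by blast
  then obtain D where D: "D i \<in> sets borel" "- A i \<subseteq> D i" "measure \<mu> (D i) \<le> s i" for i
    by metis
  have "summable (\<lambda>i. measure \<mu> (D i))"
    using D(3) by (intro summable_comparison_test'[OF assms(4)]) auto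
  then have "limsup D \<in> null_sets \<mu>"
    using D(1) by (intro borel_cantelli_limsup1) (auto simp: less_top[symmetric])
  moreover have "- limsup D \<subseteq> (\<Union>m\<in>{1..}. \<Inter>i\<in>{m..}. A i)"
  proof
    fix x assume "x \<in> - limsup D"
    then obtain m where "\<forall>i\<ge>m. x \<notin> D i"
      by (auto simp: limsup_INF_SUP)
    then have "x \<in> (\<Inter>i\<in>{Suc m..}. A i)" using D(2) by fastforce
    then show "x \<in> (\<Union>m\<in>{1..}. \<Inter>i\<in>{m..}. A i)" by fastforce
  qed
  ultimately show ?thesis by (rule null_set_imp_II_wins)
qed

end
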